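(* Let $r=r(\nu)$ and $\kappa=\kappa(\nu)$ be smooth functions of $\nu>0$ with $r(\nu)>0$ and $\nu r'(\nu)>r(\nu)$. For smooth solutions $(\nu,U^\alpha)$, the Euler–Korteweg system $$\bar T^{\alpha\beta}{}_{,\beta}=0,\qquad \bar T^{\alpha\beta}=\bar\rho\, U^\alpha U^\beta+\bar p\,\Pi^{\alpha\beta}+\kappa(\nu)\,\nu^{,\alpha}\nu^{,\beta},$$ is equivalent to the pair consisting of the companion law $$(\nu U^\beta)_{,\beta}=0$$ and the equations of motion $$U^\beta\big(\bar f\,U^\alpha\big)_{,\beta}+\bar f^{,\alpha}=0,$$ where $\bar f$ is the extended Lichnerowicz index $$\bar f(\nu,\partial\nu,\partial^2\nu)=\frac{\delta\bar\rho(\nu,\partial\nu)}{\delta\nu}.$$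
   Context: Space-time is Minkowski space with metric $g=\mathrm{diag}(-1,1,1,1)$; Greek indices run over $0,1,2,3$, are raised and lowered with $g$, repeated indices are summed, and $_{,\beta}$ denotes $\partial/\partial x^\beta$. The unknowns are a scalar field $\nu>0$ and the 4-velocity $U^\alpha$ with $U^\alpha U_\alpha=-1$; $\Pi^{\alpha\beta}=g^{\alpha\beta}+U^\alpha U^\beta$. The function $r$ gives the (non-extended) energy density $\rho=r(\nu)$ of the barotropic fluid; $r$ need not be convex. The extended energy is $$\bar\rho(\nu,\partial\nu)=r(\nu)+\tfrac12\kappa(\nu)\,\nu_{,\gamma}\nu^{,\gamma},$$ its variational derivative is $$\frac{\delta\bar\rho}{\delta\nu}=\frac{\partial\bar\rho}{\partial\nu}-\left(\frac{\partial\bar\rho}{\partial\nu_{,\gamma}}\right)_{,\gamma},$$ and the extended pressure is $$\bar p(\nu,\partial\nu,\partial^2\nu)=\nu\,\frac{\delta\bar\rho(\nu,\partial\nu)}{\delta\nu}-\bar\rho(\nu,\partial\nu).$$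
   Formalization: The equivalence is proved assuming the extended Lichnerowicz index does not vanish identically on a nonempty open set; otherwise the companion law can fail. Without this, the pair still implies Euler–Korteweg, and Euler–Korteweg implies the equations of motion. *)

theory Defs
  imports "HOL-Analysis.Analysis"
begin

text \<open>
  Space-time is \<^typ>\<open>real^4\<close>.  The elements of the index type \<^typ>\<open>4\<close> are the residues
  \<open>0, 1, 2, 3\<close>, so a Greek index is a term of type \<^typ>\<open>4\<close> and \<open>0\<close> is the time index.
  A vector of type \<^typ>\<open>real^4\<close> may hold upper or lower components; \<open>raise\<close> and \<open>mdot\<close>
  below are only applied to lower, respectively upper, components.
\<close>

type_synonym spacetime = "real^4"

subsection \<open>Smooth functions\<close>

text \<open>
  For open \<open>D\<close>: all partial derivatives up to order \<open>k\<close> exist and are continuous on \<open>D\<close>.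
  The values of the function outside \<open>D\<close> are irrelevant.
\<close>

primrec Ck_on :: "nat \<Rightarrow> 'a set \<Rightarrow> ('a::euclidean_space \<Rightarrow> 'b::real_normed_vector) \<Rightarrow> bool" where
  "Ck_on 0 D f \<longleftrightarrow> continuous_on D f"
| "Ck_on (Suc k) D f \<longleftrightarrow> (\<forall>x\<in>D. f differentiable (at x)) \<and>
     (\<forall>b\<in>Basis. Ck_on k D (\<lambda>x. frechet_derivative f (at x) b))"

definition smooth_on :: "'a set \<Rightarrow> ('a::euclidean_space \<Rightarrow> 'b::real_normed_vector) \<Rightarrow> bool" where
  "smooth_on D f \<longleftrightarrow> (\<forall>k. Ck_on k D f)"

subsection \<open>Minkowski space\<close>

text \<open>The matrix is its own inverse, so \<open>g\<close> serves for both \<open>g\<^sub>\<alpha>\<^sub>\<beta>\<close> and \<open>g\<^sup>\<alpha>\<^sup>\<beta>\<close>.\<close>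

definition g :: "4 \<Rightarrow> 4 \<Rightarrow> real" where
  "g \<alpha> \<beta> = (if \<alpha> = \<beta> then (if \<alpha> = 0 then -1 else 1) else 0)"

definition mdot :: "spacetime \<Rightarrow> spacetime \<Rightarrow> real" where
  "mdot u v = (\<Sum>\<alpha>\<in>UNIV. \<Sum>\<beta>\<in>UNIV. g \<alpha> \<beta> * u $ \<alpha> * v $ \<beta>)"

definition raise :: "spacetime \<Rightarrow> spacetime" where
  "raise p = (\<chi> \<alpha>. \<Sum>\<beta>\<in>UNIV. g \<alpha> \<beta> * p $ \<beta>)"

definition partial :: "4 \<Rightarrow> (spacetime \<Rightarrow> real) \<Rightarrow> spacetime \<Rightarrow> real" where
  "partial \<beta> h x = frechet_derivative h (at x) (axis \<beta> 1)"

definition grad :: "(spacetime \<Rightarrow> real) \<Rightarrow> spacetime \<Rightarrow> spacetime" where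
  "grad h x = (\<chi> \<beta>. partial \<beta> h x)"

definition grad_up :: "(spacetime \<Rightarrow> real) \<Rightarrow> spacetime \<Rightarrow> spacetime" where
  "grad_up h x = raise (grad h x)"

definition Proj :: "(spacetime \<Rightarrow> spacetime) \<Rightarrow> 4 \<Rightarrow> 4 \<Rightarrow> spacetime \<Rightarrow> real" where
  "Proj U \<alpha> \<beta> x = g \<alpha> \<beta> + U x $ \<alpha> * U x $ \<beta>"

subsection \<open>Extended energy, index and pressure\<close>

text \<open>
  The extended energy is a function of the independent arguments \<open>n\<close> (for \<open>\<nu>\<close>) and
  \<open>p\<close> (for the lower components \<open>\<nu>\<^sub>,\<^sub>\<gamma>\<close>); the variational derivative differentiates it
  with respect to these before the field is inserted.
\<close>

definition ext_energy :: "(real \<Rightarrow> real) \<Rightarrow> (real \<Rightarrow> real) \<Rightarrow> real \<Rightarrow> spacetime \<Rightarrow> real" where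
  "ext_energy r \<kappa> n p = r n + 1/2 * \<kappa> n * (\<Sum>\<gamma>\<in>UNIV. p $ \<gamma> * raise p $ \<gamma>)"

definition var_deriv ::
  "(real \<Rightarrow> spacetime \<Rightarrow> real) \<Rightarrow> (spacetime \<Rightarrow> real) \<Rightarrow> spacetime \<Rightarrow> real" where
  "var_deriv L \<nu> x =
     deriv (\<lambda>n. L n (grad \<nu> x)) (\<nu> x)
     - (\<Sum>\<gamma>\<in>UNIV. partial \<gamma> (\<lambda>y. partial \<gamma> (\<lambda>p. L (\<nu> y) p) (grad \<nu> y)) x)"

definition ext_rho :: "(real \<Rightarrow> real) \<Rightarrow> (real \<Rightarrow> real) \<Rightarrow> (spacetime \<Rightarrow> real) \<Rightarrow> spacetime \<Rightarrow> real" where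
  "ext_rho r \<kappa> \<nu> x = ext_energy r \<kappa> (\<nu> x) (grad \<nu> x)"

definition ext_index :: "(real \<Rightarrow> real) \<Rightarrow> (real \<Rightarrow> real) \<Rightarrow> (spacetime \<Rightarrow> real) \<Rightarrow> spacetime \<Rightarrow> real" where
  "ext_index r \<kappa> \<nu> x = var_deriv (ext_energy r \<kappa>) \<nu> x"

definition ext_pressure :: "(real \<Rightarrow> real) \<Rightarrow> (real \<Rightarrow> real) \<Rightarrow> (spacetime \<Rightarrow> real) \<Rightarrow> spacetime \<Rightarrow> real" where
  "ext_pressure r \<kappa> \<nu> x = \<nu> x * var_deriv (ext_energy r \<kappa>) \<nu> x - ext_rho r \<kappa> \<nu> x"

definition ext_T ::
  "(real \<Rightarrow> real) \<Rightarrow> (real \<Rightarrow> real) \<Rightarrow> (spacetime \<Rightarrow> real) \<Rightarrow> (spacetime \<Rightarrow> spacetime)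
    \<Rightarrow> 4 \<Rightarrow> 4 \<Rightarrow> spacetime \<Rightarrow> real" where
  "ext_T r \<kappa> \<nu> U \<alpha> \<beta> x =
     ext_rho r \<kappa> \<nu> x * U x $ \<alpha> * U x $ \<beta> + ext_pressure r \<kappa> \<nu> x * Proj U \<alpha> \<beta> x
     + \<kappa> (\<nu> x) * grad_up \<nu> x $ \<alpha> * grad_up \<nu> x $ \<beta>"

subsection \<open>The systems of equations on a domain\<close>

definition euler_korteweg_on ::
  "spacetime set \<Rightarrow> (real \<Rightarrow> real) \<Rightarrow> (real \<Rightarrow> real) \<Rightarrow> (spacetime \<Rightarrow> real)
    \<Rightarrow> (spacetime \<Rightarrow> spacetime) \<Rightarrow> bool" where
  "euler_korteweg_on D r \<kappa> \<nu> U \<longleftrightarrow>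
     (\<forall>x\<in>D. \<forall>\<alpha>. (\<Sum>\<beta>\<in>UNIV. partial \<beta> (ext_T r \<kappa> \<nu> U \<alpha> \<beta>) x) = 0)"

definition companion_law_on ::
  "spacetime set \<Rightarrow> (spacetime \<Rightarrow> real) \<Rightarrow> (spacetime \<Rightarrow> spacetime) \<Rightarrow> bool" where
  "companion_law_on D \<nu> U \<longleftrightarrow>
     (\<forall>x\<in>D. (\<Sum>\<beta>\<in>UNIV. partial \<beta> (\<lambda>y. \<nu> y * U y $ \<beta>) x) = 0)"

definition eqs_of_motion_on ::
  "spacetime set \<Rightarrow> (real \<Rightarrow> real) \<Rightarrow> (real \<Rightarrow> real) \<Rightarrow> (spacetime \<Rightarrow> real)
    \<Rightarrow> (spacetime \<Rightarrow> spacetime) \<Rightarrow> bool" where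
  "eqs_of_motion_on D r \<kappa> \<nu> U \<longleftrightarrow>
     (\<forall>x\<in>D. \<forall>\<alpha>.
        (\<Sum>\<beta>\<in>UNIV. U x $ \<beta> * partial \<beta> (\<lambda>y. ext_index r \<kappa> \<nu> y * U y $ \<alpha>) x)
        + grad_up (ext_index r \<kappa> \<nu>) x $ \<alpha> = 0)"

text \<open>
  Contracting the divergence of \<open>ext_T\<close> with \<open>U\<^sub>\<alpha>\<close> gives the left-hand side of the
  companion law times minus the extended index, so the companion law cannot be recovered on
  an open set where the index vanishes identically.  This cannot happen for \<open>\<kappa> = 0\<close>, where
  the index is \<open>r' > 0\<close>, but it can for general \<open>\<kappa>\<close>: take \<open>r n = n\<^sup>2\<close>, \<open>\<kappa> = 1\<close>,
  \<open>\<nu> = cosh (sqrt 2 * x\<^sub>1)\<close>, for which the index is 0 everywhere and the Euler-Korteweg system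
  holds for every \<open>U\<close>.
\<close>

definition index_nondegenerate_on ::
  "spacetime set \<Rightarrow> (real \<Rightarrow> real) \<Rightarrow> (real \<Rightarrow> real) \<Rightarrow> (spacetime \<Rightarrow> real) \<Rightarrow> bool" where
  "index_nondegenerate_on D r \<kappa> \<nu> \<longleftrightarrow>
     (\<forall>V. open V \<and> V \<noteq> {} \<and> V \<subseteq> D \<longrightarrow> (\<exists>x\<in>V. ext_index r \<kappa> \<nu> x \<noteq> 0))"

end

theory Submission
  imports Defs
begin

text \<open>
  Write \<open>f\<close> for the index, \<open>C = (\<nu> U\<^sup>\<beta>)\<^sub>,\<^sub>\<beta>\<close> and \<open>M\<^sup>\<alpha> = U\<^sup>\<beta> (f U\<^sup>\<alpha>)\<^sub>,\<^sub>\<beta> + f\<^sup>,\<^sup>\<alpha>\<close>.  Since the pressure is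
  \<open>\<nu> f - \<rho>\<close>, the stress is \<open>\<nu> f U\<^sup>\<alpha> U\<^sup>\<beta> + (\<nu> f - \<rho>) g\<^sup>\<alpha>\<^sup>\<beta> + \<kappa> \<nu>\<^sup>,\<^sup>\<alpha> \<nu>\<^sup>,\<^sup>\<beta>\<close>; the Euler-Lagrange form
  of \<open>f\<close> and the symmetry of second derivatives of \<open>\<nu>\<close> give the off-shell identity that its
  divergence is \<open>f C U\<^sup>\<alpha> + \<nu> M\<^sup>\<alpha>\<close>.  The normalization of \<open>U\<close> makes \<open>M\<close> orthogonal to \<open>U\<close>, so
  contracting with \<open>U\<^sub>\<alpha>\<close> isolates \<open>- f C\<close>.  Hence the Euler-Korteweg system amounts to \<open>f C = 0\<close>
  and \<open>M = 0\<close>, and \<open>C\<close> vanishes by continuity where \<open>f\<close> is nonzero on a dense set.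
\<close>

subsection \<open>Symmetry of second derivatives\<close>

text \<open>The second difference over the parallelogram spanned by \<open>h u\<close> and
  \<open>h v\<close> is an increment along \<open>u\<close> of an increment along \<open>v\<close>.
  The one-dimensional mean value theorem, applied first along \<open>u\<close> and then along
  \<open>v\<close>, turns it into a second derivative at an intermediate point.\<close>

lemma second_difference_mvt:
  fixes \<phi> :: "'a::real_normed_vector \<Rightarrow> real"
  assumes \<phi>: "\<And>y. y \<in> D \<Longrightarrow> (\<phi> has_derivative \<phi>' y) (at y)"
    and A: "\<And>y. y \<in> D \<Longrightarrow> ((\<lambda>y. \<phi>' y u) has_derivative A y) (at y)"
    and D: "cball x (h * (norm u + norm v)) \<subseteq> D" and h: "h > 0"
  shows "\<exists>y\<in>cball x (h * (norm u + norm v)).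
    \<phi> (x + h *\<^sub>R u + h *\<^sub>R v) - \<phi> (x + h *\<^sub>R u) - \<phi> (x + h *\<^sub>R v) + \<phi> x = h * h * A y v"
proof -
  \<comment> \<open>The whole parallelogram lies in the ball, so both mean value steps stay inside
    \<open>D\<close>.\<close>
  have mem: "x + s *\<^sub>R u + t *\<^sub>R v \<in> cball x (h * (norm u + norm v))"
    if "0 \<le> s" "s \<le> h" "0 \<le> t" "t \<le> h" for s t
  proof -
    have "norm (s *\<^sub>R u + t *\<^sub>R v) \<le> s * norm u + t * norm v"
      using norm_triangle_ineq[of "s *\<^sub>R u" "t *\<^sub>R v"] that by simp
    also have "\<dots> \<le> h * norm u + h * norm v"
      using that by (intro add_mono mult_right_mono) auto
    finally show ?thesis
      by (simp add: dist_norm algebra_simps norm_minus_commute[of x])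
        (metis add.commute diff_add_cancel minus_add_distrib norm_minus_cancel uminus_add_conv_diff)
  qed
  note inD = subsetD[OF D mem]
  have line_u: "((\<lambda>s. x + s *\<^sub>R u + t *\<^sub>R v) has_derivative (\<lambda>d. d *\<^sub>R u)) (at s)" for s t
    by (auto intro!: derivative_eq_intros)
  have line_v: "((\<lambda>t. x + s *\<^sub>R u + t *\<^sub>R v) has_derivative (\<lambda>d. d *\<^sub>R v)) (at t)" for s t
    by (auto intro!: derivative_eq_intros)
  \<comment> \<open>The term \<open>0 *\<^sub>R v\<close> is kept so that both summands are
    instances, for \<open>t = h\<close> and \<open>t = 0\<close>, of one derivative claim.\<close>
  define G where "G = (\<lambda>s. \<phi> (x + s *\<^sub>R u + h *\<^sub>R v) - \<phi> (x + s *\<^sub>R u + 0 *\<^sub>R v))"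
  have dG: "(G has_real_derivative
      (\<phi>' (x + s *\<^sub>R u + h *\<^sub>R v) u - \<phi>' (x + s *\<^sub>R u + 0 *\<^sub>R v) u)) (at s)"
    if "0 \<le> s" "s \<le> h" for s
  proof -
    have "((\<lambda>s. \<phi> (x + s *\<^sub>R u + t *\<^sub>R v)) has_real_derivative \<phi>' (x + s *\<^sub>R u + t *\<^sub>R v) u) (at s)"
      if "0 \<le> t" "t \<le> h" for t
    proof -
      have D': "(\<phi> has_derivative \<phi>' (x + s *\<^sub>R u + t *\<^sub>R v)) (at (x + s *\<^sub>R u + t *\<^sub>R v))"
        using \<phi> inD \<open>0 \<le> s\<close> \<open>s \<le> h\<close> that by blast
      have "((\<lambda>s. \<phi> (x + s *\<^sub>R u + t *\<^sub>R v)) has_derivative (\<lambda>d. \<phi>' (x + s *\<^sub>R u + t *\<^sub>R v) (d *\<^sub>R u))) (at s)"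
        using diff_chain_at[OF line_u D'] by (simp add: o_def)
      then show ?thesis
        unfolding has_field_derivative_def
        by (simp add: linear_scale[OF has_derivative_linear[OF D']] mult_commute_abs)
    qed
    from DERIV_diff[OF this[of h] this[of 0]] h show ?thesis
      unfolding G_def by simp
  qed
  from MVT2[OF h dG] obtain s where s: "0 < s" "s < h"
    and Gs: "G h - G 0 = h * (\<phi>' (x + s *\<^sub>R u + h *\<^sub>R v) u - \<phi>' (x + s *\<^sub>R u + 0 *\<^sub>R v) u)"
    by auto
  have dH: "((\<lambda>t. \<phi>' (x + s *\<^sub>R u + t *\<^sub>R v) u) has_real_derivative A (x + s *\<^sub>R u + t *\<^sub>R v) v) (at t)"
    if "0 \<le> t" "t \<le> h" for t
  proof -
    have D': "((\<lambda>y. \<phi>' y u) has_derivative A (x + s *\<^sub>R u + t *\<^sub>R v)) (at (x + s *\<^sub>R u + t *\<^sub>R v))"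
      using A inD s that by (meson less_imp_le)
    have "((\<lambda>t. \<phi>' (x + s *\<^sub>R u + t *\<^sub>R v) u) has_derivative
        (\<lambda>d. A (x + s *\<^sub>R u + t *\<^sub>R v) (d *\<^sub>R v))) (at t)"
      using diff_chain_at[OF line_v D'] by (simp add: o_def)
    then show ?thesis
      unfolding has_field_derivative_def
      by (simp add: linear_scale[OF has_derivative_linear[OF D']] mult_commute_abs)
  qed
  from MVT2[OF h dH] obtain t where t: "0 < t" "t < h"
    and "\<phi>' (x + s *\<^sub>R u + h *\<^sub>R v) u - \<phi>' (x + s *\<^sub>R u + 0 *\<^sub>R v) u = h * A (x + s *\<^sub>R u + t *\<^sub>R v) v"
    by auto
  with Gs have "\<phi> (x + h *\<^sub>R u + h *\<^sub>R v) - \<phi> (x + h *\<^sub>R u) - \<phi> (x + h *\<^sub>R v) + \<phi> x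
      = h * h * A (x + s *\<^sub>R u + t *\<^sub>R v) v"
    by (simp add: G_def)
  then show ?thesis
    using mem s t by (meson less_imp_le)
qed

text \<open>The second difference is symmetric in \<open>u\<close> and \<open>v\<close>, so it
  equals both \<open>h * h * A y v\<close> and \<open>h * h * B z u\<close> for some
  \<open>y\<close>, \<open>z\<close> near \<open>x\<close>. Continuity at \<open>x\<close> then
  excludes a gap between \<open>A x v\<close> and \<open>B x u\<close>.\<close>

lemma mixed_second_derivatives_eq:
  fixes \<phi> :: "'a::real_normed_vector \<Rightarrow> real"
  assumes "open D" "x \<in> D"
    and \<phi>: "\<And>y. y \<in> D \<Longrightarrow> (\<phi> has_derivative \<phi>' y) (at y)"
    and A: "\<And>y. y \<in> D \<Longrightarrow> ((\<lambda>y. \<phi>' y u) has_derivative A y) (at y)"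
    and B: "\<And>y. y \<in> D \<Longrightarrow> ((\<lambda>y. \<phi>' y v) has_derivative B y) (at y)"
    and "continuous_on D (\<lambda>y. A y v)" "continuous_on D (\<lambda>y. B y u)"
  shows "A x v = B x u"
proof (rule ccontr)
  \<comment> \<open>Half the gap: two equal numbers, each within less than \<open>e\<close> of one
    of the two values, would make the gap smaller than \<open>2 * e\<close>, which is the gap
    itself.\<close>
  define e where "e = \<bar>A x v - B x u\<bar> / 2"
  assume "A x v \<noteq> B x u"
  then have "e > 0" by (simp add: e_def)
  have "isCont (\<lambda>y. A y v) x" "isCont (\<lambda>y. B y u) x"
    using assms continuous_on_eq_continuous_at by blast+
  then have "\<forall>\<^sub>F y in at x. dist (A y v) (A x v) < e" "\<forall>\<^sub>F y in at x. dist (B y u) (B x u) < e"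
    using \<open>e > 0\<close> by (auto simp: isCont_def intro: tendstoD)
  then obtain d1 d2 where d: "d1 > 0" "d2 > 0"
    and dA: "\<And>y. y \<noteq> x \<Longrightarrow> dist y x < d1 \<Longrightarrow> dist (A y v) (A x v) < e"
    and dB: "\<And>y. y \<noteq> x \<Longrightarrow> dist y x < d2 \<Longrightarrow> dist (B y u) (B x u) < e"
    by (auto simp: eventually_at)
  obtain d3 where d3: "d3 > 0" "ball x d3 \<subseteq> D"
    using assms openE by blast
  define d where "d = min d1 (min d2 d3)"
  \<comment> \<open>The summand 1 keeps the denominator positive when \<open>u = v = 0\<close> and
    makes the radius \<open>h * (norm u + norm v)\<close> strictly smaller than
    \<open>d\<close>.\<close>
  define h where "h = d / (norm u + norm v + 1)"
  have "d > 0" using d d3 by (simp add: d_def)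
  have "norm u + norm v + 1 > 0" by (simp add: add_nonneg_pos)
  then have h: "h > 0" "h * (norm u + norm v) < d"
    using \<open>d > 0\<close> by (auto simp: h_def field_simps)
  then have sub: "cball x (h * (norm u + norm v)) \<subseteq> D"
    using d3 by (auto simp: d_def)
  from second_difference_mvt[OF \<phi> A sub h(1)] obtain y where
    y: "y \<in> cball x (h * (norm u + norm v))" and
    yA: "\<phi> (x + h *\<^sub>R u + h *\<^sub>R v) - \<phi> (x + h *\<^sub>R u) - \<phi> (x + h *\<^sub>R v) + \<phi> x = h * h * A y v"
    by blast
  have sub': "cball x (h * (norm v + norm u)) \<subseteq> D"
    using sub by (simp add: add.commute)
  from second_difference_mvt[OF \<phi> B sub' h(1)] obtain z where
    z: "z \<in> cball x (h * (norm u + norm v))" and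
    zB: "\<phi> (x + h *\<^sub>R v + h *\<^sub>R u) - \<phi> (x + h *\<^sub>R v) - \<phi> (x + h *\<^sub>R u) + \<phi> x = h * h * B z u"
    by (auto simp: add.commute)
  have "x + h *\<^sub>R v + h *\<^sub>R u = x + h *\<^sub>R u + h *\<^sub>R v" by simp
  with zB have "\<phi> (x + h *\<^sub>R u + h *\<^sub>R v) - \<phi> (x + h *\<^sub>R v) - \<phi> (x + h *\<^sub>R u) + \<phi> x = h * h * B z u"
    by (simp only:)
  with yA have "h * h * A y v = h * h * B z u" by linarith
  with h have "A y v = B z u" by simp
  moreover have "dist (A y v) (A x v) < e"
    \<comment> \<open>The filter \<open>at x\<close> omits \<open>x\<close> itself, so the case
      \<open>y = x\<close> is separate; there the distance is 0.\<close>
    using y h dA[of y] \<open>e > 0\<close> by (cases "y = x") (auto simp: d_def dist_commute)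
  moreover have "dist (B z u) (B x u) < e"
    using z h dB[of z] \<open>e > 0\<close> by (cases "z = x") (auto simp: d_def dist_commute)
  ultimately show False
    unfolding e_def dist_real_def by (smt (verit) field_sum_of_halves)
qed

subsection \<open>Smooth functions and partial derivatives\<close>

lemma smooth_on_differentiable: "smooth_on D f \<Longrightarrow> x \<in> D \<Longrightarrow> f differentiable (at x)"
  unfolding smooth_on_def by (metis Ck_on.simps(2))

lemma smooth_on_continuous: "smooth_on D f \<Longrightarrow> continuous_on D f"
  unfolding smooth_on_def by (metis Ck_on.simps(1))

lemma smooth_on_frechet_derivative:
  "smooth_on D f \<Longrightarrow> b \<in> Basis \<Longrightarrow> smooth_on D (\<lambda>x. frechet_derivative f (at x) b)"
  unfolding smooth_on_def by (metis Ck_on.simps(2))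

lemma axis_one_in_Basis: "axis \<beta> (1::real) \<in> Basis"
  by (simp add: axis_in_Basis_iff)

lemma smooth_on_partial: "smooth_on D h \<Longrightarrow> smooth_on D (partial \<beta> h)"
  using smooth_on_frechet_derivative[OF _ axis_one_in_Basis] unfolding partial_def .

lemma differentiable_cong_open:
  assumes "f differentiable (at x)" "open X" "x \<in> X" "\<And>y. y \<in> X \<Longrightarrow> f y = h y"
  shows "h differentiable (at x)"
  using assms has_derivative_transform_within_open unfolding differentiable_def by blast

lemma partial_has_derivative: "(h has_derivative h') (at x) \<Longrightarrow> partial \<beta> h x = h' (axis \<beta> 1)"
  unfolding partial_def by (metis frechet_derivative_at)

lemma partial_cong_open:
  assumes "open D" "x \<in> D" "h differentiable (at x)" "\<And>y. y \<in> D \<Longrightarrow> h y = k y"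
  shows "partial \<beta> h x = partial \<beta> k x"
  unfolding partial_def using frechet_derivative_transform_within_open[OF assms(3,1,2,4)] by simp

lemma partial_const: "partial \<beta> (\<lambda>y. c) x = 0"
  by (rule partial_has_derivative) (rule has_derivative_const)

lemma partial_add:
  "h differentiable (at x) \<Longrightarrow> k differentiable (at x) \<Longrightarrow>
    partial \<beta> (\<lambda>y. h y + k y) x = partial \<beta> h x + partial \<beta> k x"
  using partial_has_derivative[OF has_derivative_add] frechet_derivative_works
  unfolding partial_def by blast

lemma partial_diff:
  "h differentiable (at x) \<Longrightarrow> k differentiable (at x) \<Longrightarrow>
    partial \<beta> (\<lambda>y. h y - k y) x = partial \<beta> h x - partial \<beta> k x"
  using partial_has_derivative[OF has_derivative_diff] frechet_derivative_works
  unfolding partial_def by blast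

lemma partial_mult:
  assumes "h differentiable (at x)" "k differentiable (at x)"
  shows "partial \<beta> (\<lambda>y. h y * k y) x = h x * partial \<beta> k x + partial \<beta> h x * k x"
  using partial_has_derivative[OF has_derivative_mult] assms frechet_derivative_works
  unfolding partial_def by blast

lemma partial_cmult: "h differentiable (at x) \<Longrightarrow> partial \<beta> (\<lambda>y. c * h y) x = c * partial \<beta> h x"
  by (simp add: partial_mult partial_const)

lemma partial_sum:
  assumes "\<And>i. i \<in> I \<Longrightarrow> h i differentiable (at x)"
  shows "partial \<beta> (\<lambda>y. \<Sum>i\<in>I. h i y) x = (\<Sum>i\<in>I. partial \<beta> (h i) x)"
proof -
  have "((\<lambda>y. \<Sum>i\<in>I. h i y) has_derivative (\<lambda>d. \<Sum>i\<in>I. frechet_derivative (h i) (at x) d)) (at x)"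
    using assms by (intro has_derivative_sum) (simp add: frechet_derivative_works)
  from partial_has_derivative[OF this] show ?thesis
    by (simp add: partial_def)
qed

lemma differentiable_compose_real:
  fixes \<psi> :: "real \<Rightarrow> real"
  assumes "\<psi> differentiable (at (h x))" "h differentiable (at x)"
  shows "(\<lambda>y. \<psi> (h y)) differentiable (at x)"
  using differentiable_chain_at[OF assms(2,1)] by (simp add: o_def)

lemma partial_compose:
  fixes \<psi> :: "real \<Rightarrow> real"
  assumes "\<psi> differentiable (at (h x))" "h differentiable (at x)"
  shows "partial \<beta> (\<lambda>y. \<psi> (h y)) x = deriv \<psi> (h x) * partial \<beta> h x"
proof -
  have "(\<psi> has_derivative (*) (deriv \<psi> (h x))) (at (h x))"
    using assms DERIV_deriv_iff_real_differentiable has_field_derivative_def by blast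
  from diff_chain_at[OF assms(2)[unfolded frechet_derivative_works] this]
  show ?thesis
    using partial_has_derivative by (fastforce simp: partial_def o_def)
qed

lemma partial_commute:
  assumes "open D" "smooth_on D h" "x \<in> D"
  shows "partial \<beta> (partial \<gamma> h) x = partial \<gamma> (partial \<beta> h) x"
proof -
  have d: "(h has_derivative frechet_derivative h (at y)) (at y)" if "y \<in> D" for y
    using smooth_on_differentiable[OF assms(2) that] frechet_derivative_works by blast
  have dd: "((\<lambda>y. frechet_derivative h (at y) (axis \<delta> 1)) has_derivative
      frechet_derivative (partial \<delta> h) (at y)) (at y)" if "y \<in> D" for y \<delta>
    using smooth_on_differentiable[OF smooth_on_partial[OF assms(2)] that]
    unfolding frechet_derivative_works by (simp add: partial_def[abs_def])
  have c: "continuous_on D (\<lambda>y. frechet_derivative (partial \<delta> h) (at y) (axis \<epsilon> 1))" for \<delta> \<epsilon>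
    using smooth_on_continuous[OF smooth_on_partial[OF smooth_on_partial[OF assms(2)]]]
    by (simp add: partial_def[abs_def])
  show ?thesis
    using mixed_second_derivatives_eq[OF assms(1,3) d dd dd c c, of \<gamma> \<beta>] by (simp add: partial_def[abs_def])
qed

text \<open>\<open>smooth_on\<close> controls Frechet derivatives in basis directions. On the reals
  the only such direction is 1, where the Frechet derivative agrees with \<open>deriv\<close>
  throughout the open set \<open>D\<close>.\<close>

lemma smooth_on_deriv_differentiable:
  fixes \<psi> :: "real \<Rightarrow> real"
  assumes "smooth_on D \<psi>" "open D" "n \<in> D"
  shows "deriv \<psi> differentiable (at n)"
proof (rule differentiable_cong_open)
  show "(\<lambda>n. frechet_derivative \<psi> (at n) 1) differentiable (at n)"
    using assms by (intro smooth_on_differentiable[OF smooth_on_frechet_derivative]) auto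
  show "frechet_derivative \<psi> (at m) 1 = deriv \<psi> m" if "m \<in> D" for m
  proof -
    have "(\<psi> has_derivative (*) (deriv \<psi> m)) (at m)"
      using smooth_on_differentiable[OF assms(1) that] DERIV_deriv_iff_real_differentiable
        has_field_derivative_def by blast
    from frechet_derivative_at[OF this] show ?thesis by (metis mult.right_neutral)
  qed
qed (use assms in auto)

subsection \<open>Minkowski algebra\<close>

text \<open>As the metric is diagonal, each contraction with \<open>g\<close> collapses to the sign
  \<open>g \<alpha> \<alpha>\<close>; later index raising and lowering is done in this form.\<close>

lemma sum_g: "(\<Sum>\<beta>\<in>UNIV. g \<alpha> \<beta> * p \<beta>) = g \<alpha> \<alpha> * p \<alpha>"
proof -
  have "(\<Sum>\<beta>\<in>UNIV. g \<alpha> \<beta> * p \<beta>) = (\<Sum>\<beta>\<in>UNIV. if \<alpha> = \<beta> then g \<alpha> \<alpha> * p \<alpha> else 0)"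
    by (intro sum.cong) (auto simp: g_def)
  then show ?thesis by simp
qed

lemma g_diag_square: "g \<alpha> \<alpha> * (g \<alpha> \<alpha> * c) = c"
  by (simp add: g_def)

lemma raise_nth: "raise p $ \<alpha> = g \<alpha> \<alpha> * p $ \<alpha>"
  by (simp add: raise_def sum_g)

lemma grad_up_nth: "grad_up h x $ \<alpha> = g \<alpha> \<alpha> * partial \<alpha> h x"
  by (simp add: grad_up_def raise_nth grad_def)

lemma mdot_diag: "mdot u v = (\<Sum>\<alpha>\<in>UNIV. g \<alpha> \<alpha> * (u $ \<alpha> * v $ \<alpha>))"
  by (simp add: mdot_def mult.assoc sum_g)

lemma ext_energy_diag:
  "ext_energy r \<kappa> n p = r n + 1/2 * \<kappa> n * (\<Sum>\<gamma>\<in>UNIV. g \<gamma> \<gamma> * (p $ \<gamma> * p $ \<gamma>))"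
  by (simp add: ext_energy_def raise_nth mult.left_commute)

lemma differentiable_nth:
  "F differentiable (at x) \<Longrightarrow> (\<lambda>y. F y $ \<alpha>) differentiable (at x)" for F :: "_ \<Rightarrow> real^'n"
  using bounded_linear_vec_nth bounded_linear_imp_differentiable differentiable_compose by blast

lemma partial_nth:
  assumes "F differentiable (at x)"
  shows "partial \<beta> (\<lambda>y. F y $ \<alpha>) x = frechet_derivative F (at x) (axis \<beta> 1) $ \<alpha>"
  using assms partial_has_derivative
    bounded_linear.has_derivative[OF bounded_linear_vec_nth] frechet_derivative_works by blast

lemma partial_coordinate: "partial \<beta> (\<lambda>p. p $ \<gamma>) x = (if \<gamma> = \<beta> then 1 else 0)"
  by (subst partial_has_derivative[OF bounded_linear.has_derivative[OF bounded_linear_vec_nth]])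
    (rule has_derivative_ident, simp add: axis_def)

text \<open>The 2 from differentiating the quadratic form cancels the 1/2 in the energy. The
  divergence in the variational derivative is thereby that of \<kappa> times the raised
  gradient.\<close>

lemma partial_ext_energy: "partial \<gamma> (\<lambda>p. ext_energy r \<kappa> n p) p = \<kappa> n * raise p $ \<gamma>"
proof -
  let ?q = "\<lambda>p::spacetime. \<Sum>\<alpha>\<in>UNIV. g \<alpha> \<alpha> * (p $ \<alpha> * p $ \<alpha>)"
  have d: "(\<lambda>p. p $ \<alpha>) differentiable (at p)" for \<alpha> :: 4
    by (rule differentiable_nth) simp
  then have dq: "?q differentiable (at p)"
    by (auto intro!: derivative_intros)
  have "partial \<gamma> ?q p = (\<Sum>\<alpha>\<in>UNIV. partial \<gamma> (\<lambda>p. g \<alpha> \<alpha> * (p $ \<alpha> * p $ \<alpha>)) p)"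
    using d by (subst partial_sum) (auto intro!: derivative_intros)
  also have "\<dots> = (\<Sum>\<alpha>\<in>UNIV. if \<alpha> = \<gamma> then 2 * (g \<alpha> \<alpha> * p $ \<alpha>) else 0)"
    using d by (intro sum.cong) (auto simp: partial_cmult partial_mult partial_coordinate)
  finally have "partial \<gamma> ?q p = 2 * (g \<gamma> \<gamma> * p $ \<gamma>)" by simp
  moreover have "partial \<gamma> (\<lambda>p. r n + 1/2 * \<kappa> n * ?q p) p = 1/2 * \<kappa> n * partial \<gamma> ?q p"
    using dq by (subst partial_add; (subst partial_cmult)?) (auto intro!: derivative_intros simp: partial_const)
  ultimately show ?thesis
    unfolding ext_energy_diag raise_nth by simp
qed

subsection \<open>The off-shell identity\<close>

text \<open>The factors are grouped for the product rule: differentiating the first summand yields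
  the companion flux divergence and the derivative of \<open>f U\<^sup>\<alpha>\<close>, while the
  last isolates the divergence occurring in the index.\<close>

lemma ext_T_eq:
  "ext_T r \<kappa> \<nu> U \<alpha> \<beta> x =
    (ext_index r \<kappa> \<nu> x * U x $ \<alpha>) * (\<nu> x * U x $ \<beta>)
    + g \<alpha> \<beta> * (\<nu> x * ext_index r \<kappa> \<nu> x - ext_rho r \<kappa> \<nu> x)
    + (\<kappa> (\<nu> x) * grad_up \<nu> x $ \<beta>) * grad_up \<nu> x $ \<alpha>"
  by (simp add: ext_T_def ext_pressure_def ext_index_def Proj_def algebra_simps)

section \<open>Identities for the scalar field alone\<close>

locale korteweg_field =
  fixes r \<kappa> :: "real \<Rightarrow> real"
    and D :: "spacetime set"
    and \<nu> :: "spacetime \<Rightarrow> real"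
  assumes smooth_r: "smooth_on {0<..} r"
    and smooth_\<kappa>: "smooth_on {0<..} \<kappa>"
    and open_D: "open D"
    and smooth_\<nu>: "smooth_on D \<nu>"
    and \<nu>_pos: "\<And>x. x \<in> D \<Longrightarrow> \<nu> x > 0"
begin

abbreviation "f \<equiv> ext_index r \<kappa> \<nu>"

definition grad_sq :: "spacetime \<Rightarrow> real" where
  "grad_sq x = (\<Sum>\<gamma>\<in>UNIV. g \<gamma> \<gamma> * (partial \<gamma> \<nu> x * partial \<gamma> \<nu> x))"

lemma ext_rho_eq: "ext_rho r \<kappa> \<nu> x = r (\<nu> x) + 1/2 * \<kappa> (\<nu> x) * grad_sq x"
  by (simp add: ext_rho_def ext_energy_diag grad_def grad_sq_def)

lemma diff_\<nu>: "x \<in> D \<Longrightarrow> \<nu> differentiable (at x)"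
  by (rule smooth_on_differentiable[OF smooth_\<nu>])

lemma diff_partial_\<nu>: "x \<in> D \<Longrightarrow> partial \<gamma> \<nu> differentiable (at x)"
  by (rule smooth_on_differentiable[OF smooth_on_partial[OF smooth_\<nu>]])

lemma diff_partial_partial_\<nu>: "x \<in> D \<Longrightarrow> partial \<beta> (partial \<gamma> \<nu>) differentiable (at x)"
  by (rule smooth_on_differentiable[OF smooth_on_partial[OF smooth_on_partial[OF smooth_\<nu>]]])

lemma diff_r: "x \<in> D \<Longrightarrow> r differentiable (at (\<nu> x))"
  using smooth_on_differentiable[OF smooth_r] \<nu>_pos by simp

lemma diff_\<kappa>: "x \<in> D \<Longrightarrow> \<kappa> differentiable (at (\<nu> x))"
  using smooth_on_differentiable[OF smooth_\<kappa>] \<nu>_pos by simp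

lemma diff_deriv_r: "x \<in> D \<Longrightarrow> deriv r differentiable (at (\<nu> x))"
  using smooth_on_deriv_differentiable[OF smooth_r] \<nu>_pos by simp

lemma diff_deriv_\<kappa>: "x \<in> D \<Longrightarrow> deriv \<kappa> differentiable (at (\<nu> x))"
  using smooth_on_deriv_differentiable[OF smooth_\<kappa>] \<nu>_pos by simp

lemmas diff_basic = diff_\<nu> diff_partial_\<nu> diff_partial_partial_\<nu>
  differentiable_compose_real[OF diff_r diff_\<nu>] differentiable_compose_real[OF diff_\<kappa> diff_\<nu>]
  differentiable_compose_real[OF diff_deriv_r diff_\<nu>]
  differentiable_compose_real[OF diff_deriv_\<kappa> diff_\<nu>]

lemma diff_grad_up: "x \<in> D \<Longrightarrow> (\<lambda>y. grad_up \<nu> y $ \<gamma>) differentiable (at x)"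
  unfolding grad_up_nth by (intro derivative_intros diff_basic)

lemma diff_grad_sq: "x \<in> D \<Longrightarrow> grad_sq differentiable (at x)"
  unfolding grad_sq_def[abs_def] by (intro derivative_intros diff_basic ballI) simp_all

lemma partial_grad_up: "x \<in> D \<Longrightarrow> partial \<beta> (\<lambda>y. grad_up \<nu> y $ \<gamma>) x = g \<gamma> \<gamma> * partial \<beta> (partial \<gamma> \<nu>) x"
  unfolding grad_up_nth by (simp add: partial_cmult diff_basic)

text \<open>The divergence stays unexpanded because it recurs in this form, as \<open>?S\<close>, in
  \<open>korteweg_cancellation\<close>.\<close>

lemma ext_index_eq:
  assumes "x \<in> D"
  shows "f x = deriv r (\<nu> x) + 1/2 * deriv \<kappa> (\<nu> x) * grad_sq x
    - (\<Sum>\<gamma>\<in>UNIV. partial \<gamma> (\<lambda>y. \<kappa> (\<nu> y) * grad_up \<nu> y $ \<gamma>) x)"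
proof -
  have "(r has_field_derivative deriv r (\<nu> x)) (at (\<nu> x))"
    "(\<kappa> has_field_derivative deriv \<kappa> (\<nu> x)) (at (\<nu> x))"
    using diff_r diff_\<kappa> assms DERIV_deriv_iff_real_differentiable by blast+
  then have "((\<lambda>n. r n + 1/2 * \<kappa> n * grad_sq x) has_field_derivative
      deriv r (\<nu> x) + 1/2 * deriv \<kappa> (\<nu> x) * grad_sq x) (at (\<nu> x))"
    by (auto intro!: derivative_eq_intros)
  from DERIV_imp_deriv[OF this] show ?thesis
    unfolding ext_index_def var_deriv_def partial_ext_energy
    by (simp add: ext_energy_diag grad_def grad_sq_def grad_up_def)
qed

lemma diff_f:
  assumes "x \<in> D"
  shows "f differentiable (at x)"
proof (rule differentiable_cong_open[OF _ open_D assms])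
  \<comment> \<open>This is \<open>ext_index_eq\<close> with the divergence expanded by the product
    and chain rules; each factor is then visibly differentiable.\<close>
  show "(\<lambda>y. deriv r (\<nu> y) + 1/2 * deriv \<kappa> (\<nu> y) * grad_sq y
      - (\<Sum>\<gamma>\<in>UNIV. \<kappa> (\<nu> y) * (g \<gamma> \<gamma> * partial \<gamma> (partial \<gamma> \<nu>) y)
          + deriv \<kappa> (\<nu> y) * partial \<gamma> \<nu> y * grad_up \<nu> y $ \<gamma>)) differentiable (at x)"
    using assms by (intro derivative_intros diff_basic diff_grad_up diff_grad_sq ballI) simp_all
next
  fix y assume y: "y \<in> D"
  show "deriv r (\<nu> y) + 1/2 * deriv \<kappa> (\<nu> y) * grad_sq y
      - (\<Sum>\<gamma>\<in>UNIV. \<kappa> (\<nu> y) * (g \<gamma> \<gamma> * partial \<gamma> (partial \<gamma> \<nu>) y)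
          + deriv \<kappa> (\<nu> y) * partial \<gamma> \<nu> y * grad_up \<nu> y $ \<gamma>) = f y"
    unfolding ext_index_eq[OF y]
    using y by (simp add: partial_mult diff_basic diff_grad_up partial_compose diff_\<kappa> partial_grad_up)
qed

lemma diff_rho: "x \<in> D \<Longrightarrow> ext_rho r \<kappa> \<nu> differentiable (at x)"
  unfolding ext_rho_eq[abs_def] by (intro derivative_intros diff_basic diff_grad_sq)

text \<open>The first bracket is the same as in \<open>ext_index_eq\<close>, so it drops out of
  \<open>f\<close> times the gradient of \<nu> minus the gradient of the energy.\<close>

lemma partial_rho:
  assumes "x \<in> D"
  shows "partial \<alpha> (ext_rho r \<kappa> \<nu>) x =
    (deriv r (\<nu> x) + 1/2 * deriv \<kappa> (\<nu> x) * grad_sq x) * partial \<alpha> \<nu> x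
    + \<kappa> (\<nu> x) * (\<Sum>\<gamma>\<in>UNIV. grad_up \<nu> x $ \<gamma> * partial \<alpha> (partial \<gamma> \<nu>) x)"
proof -
  have "partial \<alpha> grad_sq x = 2 * (\<Sum>\<gamma>\<in>UNIV. grad_up \<nu> x $ \<gamma> * partial \<alpha> (partial \<gamma> \<nu>) x)"
    unfolding grad_sq_def[abs_def] grad_up_nth sum_distrib_left
    using assms
    by (subst partial_sum; (subst partial_cmult)?)
      (auto intro!: derivative_intros diff_basic sum.cong simp: partial_cmult partial_mult diff_basic)
  moreover have "partial \<alpha> (\<lambda>y. r (\<nu> y) + 1/2 * (\<kappa> (\<nu> y) * grad_sq y)) x
    = partial \<alpha> (\<lambda>y. r (\<nu> y)) x + 1/2 * partial \<alpha> (\<lambda>y. \<kappa> (\<nu> y) * grad_sq y) x"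
    using assms by (subst partial_add; (subst partial_cmult)?)
      (auto intro!: derivative_intros diff_basic diff_grad_sq)
  ultimately show ?thesis
    unfolding ext_rho_eq[abs_def] mult.assoc using assms
    by (simp add: partial_mult partial_compose diff_basic diff_grad_sq diff_r diff_\<kappa> algebra_simps)
qed

text \<open>In the first bracket the terms with derivatives of \<open>r\<close> and \<kappa> in
  \<open>n\<close> cancel, leaving
  \<open>- ?S * partial \<alpha> \<nu> x - \<kappa> (\<nu> x) * ?H\<close>. The product rule for the
  Korteweg stress gives the opposite terms, up to the order of the second derivatives, which
  \<open>partial_commute\<close> settles.\<close>

lemma korteweg_cancellation:
  assumes "x \<in> D"
  shows "g \<alpha> \<alpha> * (f x * partial \<alpha> \<nu> x - partial \<alpha> (ext_rho r \<kappa> \<nu>) x)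
    + (\<Sum>\<beta>\<in>UNIV. partial \<beta> (\<lambda>y. (\<kappa> (\<nu> y) * grad_up \<nu> y $ \<beta>) * grad_up \<nu> y $ \<alpha>) x) = 0"
proof -
  let ?S = "\<Sum>\<beta>\<in>UNIV. partial \<beta> (\<lambda>y. \<kappa> (\<nu> y) * grad_up \<nu> y $ \<beta>) x"
  let ?H = "\<Sum>\<gamma>\<in>UNIV. grad_up \<nu> x $ \<gamma> * partial \<alpha> (partial \<gamma> \<nu>) x"
  have "(\<Sum>\<beta>\<in>UNIV. partial \<beta> (\<lambda>y. (\<kappa> (\<nu> y) * grad_up \<nu> y $ \<beta>) * grad_up \<nu> y $ \<alpha>) x)
    = (\<Sum>\<beta>\<in>UNIV. g \<alpha> \<alpha> * \<kappa> (\<nu> x) * (grad_up \<nu> x $ \<beta> * partial \<alpha> (partial \<beta> \<nu>) x)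
        + g \<alpha> \<alpha> * partial \<alpha> \<nu> x * partial \<beta> (\<lambda>y. \<kappa> (\<nu> y) * grad_up \<nu> y $ \<beta>) x)"
  proof (rule sum.cong[OF refl])
    fix \<beta> :: 4
    have "partial \<beta> (\<lambda>y. (\<kappa> (\<nu> y) * grad_up \<nu> y $ \<beta>) * grad_up \<nu> y $ \<alpha>) x
      = (\<kappa> (\<nu> x) * grad_up \<nu> x $ \<beta>) * (g \<alpha> \<alpha> * partial \<alpha> (partial \<beta> \<nu>) x)
        + partial \<beta> (\<lambda>y. \<kappa> (\<nu> y) * grad_up \<nu> y $ \<beta>) x * (g \<alpha> \<alpha> * partial \<alpha> \<nu> x)"
      using assms
      by (subst partial_mult) (auto intro!: derivative_intros diff_basic diff_grad_up
          simp: partial_grad_up partial_commute[OF open_D smooth_\<nu>, of x \<beta> \<alpha>] grad_up_nth[of _ x \<alpha>])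
    then show "partial \<beta> (\<lambda>y. (\<kappa> (\<nu> y) * grad_up \<nu> y $ \<beta>) * grad_up \<nu> y $ \<alpha>) x
      = g \<alpha> \<alpha> * \<kappa> (\<nu> x) * (grad_up \<nu> x $ \<beta> * partial \<alpha> (partial \<beta> \<nu>) x)
        + g \<alpha> \<alpha> * partial \<alpha> \<nu> x * partial \<beta> (\<lambda>y. \<kappa> (\<nu> y) * grad_up \<nu> y $ \<beta>) x"
      by simp
  qed
  also have "\<dots> = g \<alpha> \<alpha> * \<kappa> (\<nu> x) * ?H + g \<alpha> \<alpha> * partial \<alpha> \<nu> x * ?S"
    by (simp only: sum.distrib sum_distrib_left[symmetric])
  finally show ?thesis
    unfolding ext_index_eq[OF assms] partial_rho[OF assms] by (simp add: algebra_simps)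
qed

end

section \<open>Coupling to a unit velocity field\<close>

locale korteweg_fluid = korteweg_field +
  fixes U :: "spacetime \<Rightarrow> spacetime"
  assumes smooth_U: "smooth_on D U"
    and U_unit: "\<And>x. x \<in> D \<Longrightarrow> mdot (U x) (U x) = -1"
begin

definition flux_div :: "spacetime \<Rightarrow> real" where
  "flux_div x = (\<Sum>\<beta>\<in>UNIV. partial \<beta> (\<lambda>y. \<nu> y * U y $ \<beta>) x)"

definition motion :: "4 \<Rightarrow> spacetime \<Rightarrow> real" where
  "motion \<alpha> x = (\<Sum>\<beta>\<in>UNIV. U x $ \<beta> * partial \<beta> (\<lambda>y. f y * U y $ \<alpha>) x) + grad_up f x $ \<alpha>"

lemma diff_U: "x \<in> D \<Longrightarrow> (\<lambda>y. U y $ \<alpha>) differentiable (at x)"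
  by (rule differentiable_nth[OF smooth_on_differentiable[OF smooth_U]])

lemma div_ext_T:
  assumes "x \<in> D"
  shows "(\<Sum>\<beta>\<in>UNIV. partial \<beta> (ext_T r \<kappa> \<nu> U \<alpha> \<beta>) x)
    = f x * flux_div x * U x $ \<alpha> + \<nu> x * motion \<alpha> x"
proof -
  let ?K = "\<lambda>\<beta>. partial \<beta> (\<lambda>y. (\<kappa> (\<nu> y) * grad_up \<nu> y $ \<beta>) * grad_up \<nu> y $ \<alpha>) x"
  let ?P = "\<lambda>\<beta>. partial \<beta> (\<lambda>y. \<nu> y * f y - ext_rho r \<kappa> \<nu> y) x"
  have "partial \<beta> (ext_T r \<kappa> \<nu> U \<alpha> \<beta>) x =
      f x * U x $ \<alpha> * partial \<beta> (\<lambda>y. \<nu> y * U y $ \<beta>) x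
      + \<nu> x * (U x $ \<beta> * partial \<beta> (\<lambda>y. f y * U y $ \<alpha>) x) + g \<alpha> \<beta> * ?P \<beta> + ?K \<beta>" for \<beta>
  proof -
    have d1: "(\<lambda>y. f y * U y $ \<alpha>) differentiable (at x)"
      and d2: "(\<lambda>y. \<nu> y * U y $ \<beta>) differentiable (at x)"
      and d3: "(\<lambda>y. \<nu> y * f y - ext_rho r \<kappa> \<nu> y) differentiable (at x)"
      and d4: "(\<lambda>y. (\<kappa> (\<nu> y) * grad_up \<nu> y $ \<beta>) * grad_up \<nu> y $ \<alpha>) differentiable (at x)"
      using assms by (auto intro!: derivative_intros diff_f diff_U diff_basic diff_rho diff_grad_up)
    have d5: "(\<lambda>y. g \<alpha> \<beta> * (\<nu> y * f y - ext_rho r \<kappa> \<nu> y)) differentiable (at x)"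
      and d6: "(\<lambda>y. (f y * U y $ \<alpha>) * (\<nu> y * U y $ \<beta>)) differentiable (at x)"
      using d1 d2 d3 by (auto intro!: derivative_intros)
    show ?thesis
      unfolding ext_T_eq[abs_def] partial_add[OF differentiable_add[OF d6 d5] d4]
        partial_add[OF d6 d5] partial_mult[OF d1 d2] partial_cmult[OF d3]
      by simp
  qed
  then have "(\<Sum>\<beta>\<in>UNIV. partial \<beta> (ext_T r \<kappa> \<nu> U \<alpha> \<beta>) x) =
      f x * U x $ \<alpha> * flux_div x
      + \<nu> x * (\<Sum>\<beta>\<in>UNIV. U x $ \<beta> * partial \<beta> (\<lambda>y. f y * U y $ \<alpha>) x)
      + g \<alpha> \<alpha> * ?P \<alpha> + (\<Sum>\<beta>\<in>UNIV. ?K \<beta>)"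
    by (simp only: sum.distrib sum_distrib_left[symmetric] sum_g flux_div_def)
  \<comment> \<open>The pressure gradient splits into \<nu> times the gradient of \<open>f\<close>,
    which completes \<open>motion\<close>, and the part absorbed by
    \<open>korteweg_cancellation\<close>.\<close>
  moreover have "?P \<alpha> = \<nu> x * partial \<alpha> f x + (f x * partial \<alpha> \<nu> x - partial \<alpha> (ext_rho r \<kappa> \<nu>) x)"
    using assms by (subst partial_diff)
      (auto intro!: derivative_intros diff_f diff_basic diff_rho simp: partial_mult diff_f diff_\<nu>)
  ultimately show ?thesis
    using korteweg_cancellation[OF assms, of \<alpha>]
    by (simp add: motion_def grad_up_nth[of f] algebra_simps)
qed

text \<open>Differentiate the normalization of \<open>U\<close>, which is constant on the open set
  \<open>D\<close>.\<close>

lemma U_orthogonal_partial_U: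
  assumes "x \<in> D"
  shows "(\<Sum>\<alpha>\<in>UNIV. g \<alpha> \<alpha> * U x $ \<alpha> * partial \<beta> (\<lambda>y. U y $ \<alpha>) x) = 0"
proof -
  have "partial \<beta> (\<lambda>y. \<Sum>\<alpha>\<in>UNIV. g \<alpha> \<alpha> * (U y $ \<alpha> * U y $ \<alpha>)) x = partial \<beta> (\<lambda>y. -1) x"
    using U_unit assms unfolding mdot_diag
    by (intro partial_cong_open[OF open_D]) (auto intro!: derivative_intros diff_U)
  moreover have "partial \<beta> (\<lambda>y. \<Sum>\<alpha>\<in>UNIV. g \<alpha> \<alpha> * (U y $ \<alpha> * U y $ \<alpha>)) x
    = (\<Sum>\<alpha>\<in>UNIV. 2 * (g \<alpha> \<alpha> * U x $ \<alpha> * partial \<beta> (\<lambda>y. U y $ \<alpha>) x))"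
    using assms by (subst partial_sum)
      (auto intro!: derivative_intros sum.cong diff_U simp: partial_cmult partial_mult diff_U)
  ultimately show ?thesis
    by (simp add: partial_const sum_distrib_left[symmetric])
qed

text \<open>In the contraction, the derivatives of \<open>U\<close> drop out by
  \<open>U_orthogonal_partial_U\<close>. The normalization turns the derivatives of \<open>f\<close>
  into \<open>- U\<^sup>\<beta> f\<^sub>,\<^sub>\<beta>\<close>, which cancels the contracted
  gradient of \<open>f\<close>.\<close>

lemma U_orthogonal_motion:
  assumes "x \<in> D"
  shows "(\<Sum>\<alpha>\<in>UNIV. g \<alpha> \<alpha> * U x $ \<alpha> * motion \<alpha> x) = 0"
proof -
  have "(\<Sum>\<alpha>\<in>UNIV. g \<alpha> \<alpha> * U x $ \<alpha> * (\<Sum>\<beta>\<in>UNIV. U x $ \<beta> * partial \<beta> (\<lambda>y. f y * U y $ \<alpha>) x))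
    = (\<Sum>\<alpha>\<in>UNIV. \<Sum>\<beta>\<in>UNIV. f x * U x $ \<beta> * (g \<alpha> \<alpha> * U x $ \<alpha> * partial \<beta> (\<lambda>y. U y $ \<alpha>) x)
        + U x $ \<beta> * partial \<beta> f x * (g \<alpha> \<alpha> * (U x $ \<alpha> * U x $ \<alpha>)))"
    using assms by (simp add: sum_distrib_left partial_mult diff_f diff_U algebra_simps)
  \<comment> \<open>Moving the sum over \<alpha> inside exposes the two contractions known from
    orthogonality and normalization.\<close>
  also have "\<dots> = (\<Sum>\<beta>\<in>UNIV. \<Sum>\<alpha>\<in>UNIV. f x * U x $ \<beta> * (g \<alpha> \<alpha> * U x $ \<alpha> * partial \<beta> (\<lambda>y. U y $ \<alpha>) x)
        + U x $ \<beta> * partial \<beta> f x * (g \<alpha> \<alpha> * (U x $ \<alpha> * U x $ \<alpha>)))"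
    by (rule sum.swap)
  also have "\<dots> = - (\<Sum>\<beta>\<in>UNIV. U x $ \<beta> * partial \<beta> f x)"
    using U_orthogonal_partial_U[OF assms] U_unit[OF assms]
    by (simp add: sum.distrib sum_distrib_left[symmetric] mdot_diag sum_negf)
  finally show ?thesis
    by (simp add: motion_def grad_up_nth distrib_left sum.distrib mult.assoc mult.left_commute
        g_diag_square)
qed

text \<open>Makes the set where the flux divergence is nonzero open. Smoothness is assumed of the
  vector field \<open>U\<close>, so derivatives of its components are read off its Frechet
  derivative.\<close>

lemma continuous_flux_div: "continuous_on D flux_div"
proof -
  have "continuous_on D (\<lambda>y. \<Sum>\<beta>\<in>UNIV. \<nu> y * frechet_derivative U (at y) (axis \<beta> 1) $ \<beta>
      + partial \<beta> \<nu> y * U y $ \<beta>)"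
    by (intro continuous_intros smooth_on_continuous[OF smooth_\<nu>] smooth_on_continuous[OF smooth_U]
        smooth_on_continuous[OF smooth_on_partial[OF smooth_\<nu>]]
        smooth_on_continuous[OF smooth_on_frechet_derivative[OF smooth_U axis_one_in_Basis]])
  then show ?thesis
    by (rule continuous_on_eq)
      (simp add: flux_div_def partial_mult diff_\<nu> diff_U partial_nth
        smooth_on_differentiable[OF smooth_U])
qed

lemma companion_law_iff: "companion_law_on D \<nu> U \<longleftrightarrow> (\<forall>x\<in>D. flux_div x = 0)"
  by (simp add: companion_law_on_def flux_div_def)

lemma eqs_of_motion_iff: "eqs_of_motion_on D r \<kappa> \<nu> U \<longleftrightarrow> (\<forall>x\<in>D. \<forall>\<alpha>. motion \<alpha> x = 0)"
  by (simp add: eqs_of_motion_on_def motion_def)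

lemma euler_korteweg_iff:
  "euler_korteweg_on D r \<kappa> \<nu> U \<longleftrightarrow> (\<forall>x\<in>D. f x * flux_div x = 0 \<and> (\<forall>\<alpha>. motion \<alpha> x = 0))"
proof -
  have "f x * flux_div x = 0 \<and> (\<forall>\<alpha>. motion \<alpha> x = 0)"
    if x: "x \<in> D" and ek: "\<And>\<alpha>. f x * flux_div x * U x $ \<alpha> + \<nu> x * motion \<alpha> x = 0" for x
  proof -
    \<comment> \<open>Contraction with \<open>U\<^sub>\<alpha>\<close> removes \<open>motion\<close>
      and leaves \<open>- f x * flux_div x\<close>. Once this is 0, positivity of \<nu> makes each
      \<open>motion\<close> component vanish.\<close>
    have "0 = (\<Sum>\<alpha>\<in>UNIV. g \<alpha> \<alpha> * U x $ \<alpha> * (f x * flux_div x * U x $ \<alpha> + \<nu> x * motion \<alpha> x))"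
      by (simp add: ek)
    also have "\<dots> = (\<Sum>\<alpha>\<in>UNIV. f x * flux_div x * (g \<alpha> \<alpha> * (U x $ \<alpha> * U x $ \<alpha>))
        + \<nu> x * (g \<alpha> \<alpha> * U x $ \<alpha> * motion \<alpha> x))"
      by (simp add: algebra_simps)
    also have "\<dots> = - (f x * flux_div x)"
      using U_unit[OF x] U_orthogonal_motion[OF x]
      by (simp add: sum.distrib sum_distrib_left[symmetric] mdot_diag)
    finally have fC: "f x * flux_div x = 0" by simp
    with ek \<nu>_pos[OF x] show ?thesis by fastforce
  qed
  then show ?thesis
    unfolding euler_korteweg_on_def by (auto simp: div_ext_T)
qed

text \<open>If the flux divergence were nonzero somewhere, it would be nonzero on a nonempty open
  subset of \<open>D\<close>. Nondegeneracy gives a point there with nonzero index, contradicting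
  the vanishing product.\<close>

lemma flux_div_eq_0:
  assumes "index_nondegenerate_on D r \<kappa> \<nu>" and "\<And>x. x \<in> D \<Longrightarrow> f x * flux_div x = 0" and "x \<in> D"
  shows "flux_div x = 0"
proof (rule ccontr)
  assume "flux_div x \<noteq> 0"
  define V where "V = D \<inter> flux_div -` (- {0})"
  have "open V"
    unfolding V_def by (intro continuous_open_preimage continuous_flux_div open_D) (simp add: open_Compl)
  moreover have "x \<in> V" "V \<subseteq> D"
    using \<open>flux_div x \<noteq> 0\<close> \<open>x \<in> D\<close> by (auto simp: V_def)
  ultimately obtain y where "y \<in> V" "f y \<noteq> 0"
    using assms(1) unfolding index_nondegenerate_on_def by blast
  with assms(2)[of y] show False by (simp add: V_def)
qed

end

theorem theorem3p1:
  fixes r \<kappa> :: "real \<Rightarrow> real"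
    and D :: "spacetime set"
    and \<nu> :: "spacetime \<Rightarrow> real"
    and U :: "spacetime \<Rightarrow> spacetime"
  assumes "smooth_on {0<..} r"
    and "smooth_on {0<..} \<kappa>"
    and "\<And>n. n > 0 \<Longrightarrow> r n > 0"
    and "\<And>n. n > 0 \<Longrightarrow> n * deriv r n > r n"
    and "open D"
    and "smooth_on D \<nu>"
    and "smooth_on D U"
    and "\<And>x. x \<in> D \<Longrightarrow> \<nu> x > 0"
    and "\<And>x. x \<in> D \<Longrightarrow> mdot (U x) (U x) = -1"
  shows "(index_nondegenerate_on D r \<kappa> \<nu> \<longrightarrow>
            (euler_korteweg_on D r \<kappa> \<nu> U \<longleftrightarrow>
               companion_law_on D \<nu> U \<and> eqs_of_motion_on D r \<kappa> \<nu> U))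
       \<and> (companion_law_on D \<nu> U \<and> eqs_of_motion_on D r \<kappa> \<nu> U \<longrightarrow>
            euler_korteweg_on D r \<kappa> \<nu> U)
       \<and> (euler_korteweg_on D r \<kappa> \<nu> U \<longrightarrow> eqs_of_motion_on D r \<kappa> \<nu> U)"
proof -
  interpret korteweg_fluid r \<kappa> D \<nu> U
    using assms by unfold_locales
  show ?thesis
    \<comment> \<open>\<open>flux_div_eq_0\<close> recovers the companion law from the vanishing
      product; the other implications are read off the pointwise characterizations.\<close>
    using flux_div_eq_0 unfolding companion_law_iff eqs_of_motion_iff euler_korteweg_iff
    by auto
qed

end
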